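(* For every $n\ge 1$, any data $(X_i,D_i,Y_i)_{i=1}^n$ with $X_i\in\mathbb R^d$, $D_i\in\{0,1\}$, $Y_i\in\mathbb R$, any real weights $w_{i\leftarrow j}$ ($i,j\in\{1,\dots,n\}$, $D_i+D_j=1$) and any functions $\hat\mu_0,\hat\mu_1:\mathbb R^d\to\mathbb R$, the regression-adjusted imputation estimator $\hat\tau_w$ can be rewritten as $$\hat\tau_w=\hat\tau^{\rm reg}+\frac1n\sum_{i:D_i=1}\Big(1+\sum_{j:D_j=1-D_i}w_{j\leftarrow i}\Big)\hat R_i-\frac1n\sum_{i:D_i=0}\Big(1+\sum_{j:D_j=1-D_i}w_{j\leftarrow i}\Big)\hat R_i+\frac1n\sum_{i=1}^n(2D_i-1)\Big(1-\sum_{j:D_j=1-D_i}w_{i\leftarrow j}\Big)\hat\mu_{1-D_i}(X_i).$$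
   Context: The regression-adjusted imputed values are $\hat Y_i(D_i):=Y_i$ and $$\hat Y_i(1-D_i):=\sum_{j:D_j=1-D_i}w_{i\leftarrow j}\big(Y_j+\hat\mu_{1-D_i}(X_i)-\hat\mu_{1-D_i}(X_j)\big),$$ and $\hat\tau_w:=\frac1n\sum_{i=1}^n[\hat Y_i(1)-\hat Y_i(0)]$. Moreover $\hat R_i:=Y_i-\hat\mu_{D_i}(X_i)$ and $\hat\tau^{\rm reg}:=\frac1n\sum_{i=1}^n[\hat\mu_1(X_i)-\hat\mu_0(X_i)]$. All sums over $i$ or $j$ range over indices in $\{1,\dots,n\}$. (In the paper $\hat\mu_0,\hat\mu_1$ estimate the conditional means $\mathrm E[Y\mid X=x,D=0]$ and $\mathrm E[Y\mid X=x,D=1]$, and the weights are computed from the data; the identity is algebraic.) *)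

theory Defs
  imports "HOL-Analysis.Analysis"
begin

text \<open>
  Units are indexed by \<open>{1..n}\<close>. Treatments \<open>D i\<close> are natural numbers, assumed to be
  \<open>0\<close> or \<open>1\<close> where it matters, so the truncated difference \<open>1 - D i\<close> is the opposite
  treatment. The weight of \<open>j\<close> in the imputation for \<open>i\<close> is \<open>w i j\<close>, and the two fitted
  regression functions are \<open>\<mu> 0\<close> and \<open>\<mu> 1\<close>; other values of \<open>\<mu>\<close>, and weights of
  pairs with equal treatment, are never used.
\<close>

definition imputed ::
  "nat \<Rightarrow> (nat \<Rightarrow> real ^ 'd) \<Rightarrow> (nat \<Rightarrow> nat) \<Rightarrow> (nat \<Rightarrow> real) \<Rightarrow> (nat \<Rightarrow> nat \<Rightarrow> real)
    \<Rightarrow> (nat \<Rightarrow> real ^ 'd \<Rightarrow> real) \<Rightarrow> nat \<Rightarrow> nat \<Rightarrow> real" where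
  \<comment> \<open>For a binary treatment level \<open>a\<close>, the second branch is the case \<open>a = 1 - D i\<close>.\<close>
  "imputed n X D Y w \<mu> i a =
    (if a = D i then Y i
     else (\<Sum>j\<in>{j\<in>{1..n}. D j = 1 - D i}.
             w i j * (Y j + \<mu> (1 - D i) (X i) - \<mu> (1 - D i) (X j))))"

definition tau_w ::
  "nat \<Rightarrow> (nat \<Rightarrow> real ^ 'd) \<Rightarrow> (nat \<Rightarrow> nat) \<Rightarrow> (nat \<Rightarrow> real) \<Rightarrow> (nat \<Rightarrow> nat \<Rightarrow> real)
    \<Rightarrow> (nat \<Rightarrow> real ^ 'd \<Rightarrow> real) \<Rightarrow> real" where
  "tau_w n X D Y w \<mu> =
    1 / real n * (\<Sum>i\<in>{1..n}. imputed n X D Y w \<mu> i 1 - imputed n X D Y w \<mu> i 0)"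

definition resid ::
  "(nat \<Rightarrow> real ^ 'd) \<Rightarrow> (nat \<Rightarrow> nat) \<Rightarrow> (nat \<Rightarrow> real) \<Rightarrow> (nat \<Rightarrow> real ^ 'd \<Rightarrow> real) \<Rightarrow> nat \<Rightarrow> real" where
  "resid X D Y \<mu> i = Y i - \<mu> (D i) (X i)"

definition tau_reg :: "nat \<Rightarrow> (nat \<Rightarrow> real ^ 'd) \<Rightarrow> (nat \<Rightarrow> real ^ 'd \<Rightarrow> real) \<Rightarrow> real" where
  "tau_reg n X \<mu> = 1 / real n * (\<Sum>i\<in>{1..n}. \<mu> 1 (X i) - \<mu> 0 (X i))"

end

theory Submission
  imports Defs
begin

text \<open>
  The counterfactual imputation for a unit replaces each outcome \<open>Y j\<close> by the residual of \<open>j\<close>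
  plus the fitted value \<open>\<mu> (1 - D i) (X i)\<close>, which does not depend on \<open>j\<close> and so collects the
  total weight \<open>\<Sum>j. w i j\<close>. Comparing that total weight with \<open>1\<close> yields the last term of the
  identity, and what is left of the fitted values is the contrast \<open>\<mu> 1 - \<mu> 0\<close>. This gives a
  decomposition of each unit's imputed effect (\<open>imputed_effect\<close>) whose residual part contains
  the residual of the unit itself and those of the units imputed from.

  The sign \<open>2 D i - 1\<close> is \<open>1\<close> for treated and \<open>-1\<close> for control units, so units of opposite arms
  have opposite signs. Exchanging the order of summation (\<open>signed_opposite_sum_swap\<close>) therefore
  credits to each unit the weights with which it is used as a donor, and turns the minus sign of
  the imputed residuals into a plus. Splitting the signed sum by arm (\<open>signed_sum_by_arm\<close>) then
  separates the treated and the control residuals.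
\<close>

lemma signed_sum_by_arm:
  fixes D :: "'a \<Rightarrow> nat" and f :: "'a \<Rightarrow> real"
  assumes "finite I" and D: "\<And>i. i \<in> I \<Longrightarrow> D i \<in> {0, 1}"
  shows "(\<Sum>i\<in>I. (2 * real (D i) - 1) * f i) =
    (\<Sum>i\<in>{i\<in>I. D i = 1}. f i) - (\<Sum>i\<in>{i\<in>I. D i = 0}. f i)"
proof -
  have "(\<Sum>i\<in>I. (2 * real (D i) - 1) * f i) =
      (\<Sum>i\<in>I. (if D i = 1 then f i else 0) - (if D i = 0 then f i else 0))"
    using D by (intro sum.cong) fastforce+
  then show ?thesis
    by (simp only: sum_subtractf sum.inter_filter[OF \<open>finite I\<close>])
qed

text \<open>
  For binary treatments the relation \<open>D j = 1 - D i\<close> is symmetric, so exchanging the sums only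
  exchanges the roles of \<open>i\<close> and \<open>j\<close>; the sign changes because it is then read off at the other
  end of a pair with opposite treatments.
\<close>

lemma signed_opposite_sum_swap:
  fixes D :: "'a \<Rightarrow> nat" and g :: "'a \<Rightarrow> 'a \<Rightarrow> real"
  assumes "finite I" and D: "\<And>i. i \<in> I \<Longrightarrow> D i \<in> {0, 1}"
  shows "(\<Sum>i\<in>I. (2 * real (D i) - 1) * (\<Sum>j\<in>{j\<in>I. D j = 1 - D i}. g i j)) =
    - (\<Sum>j\<in>I. (2 * real (D j) - 1) * (\<Sum>i\<in>{i\<in>I. D i = 1 - D j}. g i j))"
proof -
  have "(\<Sum>i\<in>I. (2 * real (D i) - 1) * (\<Sum>j\<in>{j\<in>I. D j = 1 - D i}. g i j)) =
      (\<Sum>i\<in>I. \<Sum>j\<in>{j\<in>I. D j = 1 - D i}. (2 * real (D i) - 1) * g i j)"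
    by (simp add: sum_distrib_left)
  also have "\<dots> = (\<Sum>j\<in>I. \<Sum>i\<in>{i\<in>I. D j = 1 - D i}. (2 * real (D i) - 1) * g i j)"
    using \<open>finite I\<close> by (rule sum.swap_restrict[OF _ \<open>finite I\<close>])
  also have "\<dots> = (\<Sum>j\<in>I. \<Sum>i\<in>{i\<in>I. D i = 1 - D j}. - ((2 * real (D j) - 1) * g i j))"
  proof (intro sum.cong refl)
    fix j assume "j \<in> I"
    then show "{i\<in>I. D j = 1 - D i} = {i\<in>I. D i = 1 - D j}"
      using D by fastforce
  next
    fix j i assume "j \<in> I" and "i \<in> {i\<in>I. D i = 1 - D j}"
    then show "(2 * real (D i) - 1) * g i j = - ((2 * real (D j) - 1) * g i j)"
      using D[of j] by auto
  qed
  finally show ?thesis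
    by (simp add: sum_distrib_left sum_negf)
qed

text \<open>
  Imputation enters the fit for the opposite arm with the total weight as its coefficient, where
  the contrast \<open>\<mu> 1 - \<mu> 0\<close> has coefficient \<open>1\<close>; the last summand is this discrepancy. Exchanging
  the arms negates the effect, which is why the sign \<open>2 D i - 1\<close> makes one formula valid in both.
\<close>

lemma imputed_effect:
  fixes X :: "nat \<Rightarrow> real ^ 'd"
  assumes "D i \<in> {0, 1}"
  shows "imputed n X D Y w \<mu> i 1 - imputed n X D Y w \<mu> i 0 =
    \<mu> 1 (X i) - \<mu> 0 (X i)
    + (2 * real (D i) - 1) * resid X D Y \<mu> i
    - (2 * real (D i) - 1) * (\<Sum>j\<in>{j\<in>{1..n}. D j = 1 - D i}. w i j * resid X D Y \<mu> j)
    + (2 * real (D i) - 1) * (1 - (\<Sum>j\<in>{j\<in>{1..n}. D j = 1 - D i}. w i j)) * \<mu> (1 - D i) (X i)"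
proof -
  let ?J = "{j\<in>{1..n}. D j = 1 - D i}"
  \<comment> \<open>A donor \<open>j\<close> has treatment \<open>1 - D i\<close>, so the fit subtracted at \<open>X j\<close> is the one in its residual.\<close>
  have "(\<Sum>j\<in>?J. w i j * (Y j + \<mu> (1 - D i) (X i) - \<mu> (1 - D i) (X j))) =
      (\<Sum>j\<in>?J. w i j * resid X D Y \<mu> j + w i j * \<mu> (1 - D i) (X i))"
    by (intro sum.cong) (auto simp: resid_def algebra_simps)
  also have "\<dots> = (\<Sum>j\<in>?J. w i j * resid X D Y \<mu> j) + (\<Sum>j\<in>?J. w i j) * \<mu> (1 - D i) (X i)"
    by (simp add: sum.distrib sum_distrib_right)
  finally have counterfactual:
    "(\<Sum>j\<in>?J. w i j * (Y j + \<mu> (1 - D i) (X i) - \<mu> (1 - D i) (X j))) = \<dots>" .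
  consider "D i = 0" | "D i = 1" using assms by auto
  then show ?thesis
  proof cases
    case 1
    with counterfactual show ?thesis
      by (simp add: imputed_def resid_def algebra_simps)
  next
    case 2
    with counterfactual show ?thesis
      by (simp add: imputed_def resid_def algebra_simps)
  qed
qed

theorem lemma3p1:
  fixes n :: nat
    and X :: "nat \<Rightarrow> real ^ 'd"
    and D :: "nat \<Rightarrow> nat"
    and Y :: "nat \<Rightarrow> real"
    and w :: "nat \<Rightarrow> nat \<Rightarrow> real"
    and \<mu> :: "nat \<Rightarrow> real ^ 'd \<Rightarrow> real"
  assumes "n \<ge> 1"
    and "\<And>i. i \<in> {1..n} \<Longrightarrow> D i \<in> {0, 1}"
  shows "tau_w n X D Y w \<mu> =
      tau_reg n X \<mu>
      + 1 / real n * (\<Sum>i\<in>{i\<in>{1..n}. D i = 1}.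
          (1 + (\<Sum>j\<in>{j\<in>{1..n}. D j = 1 - D i}. w j i)) * resid X D Y \<mu> i)
      - 1 / real n * (\<Sum>i\<in>{i\<in>{1..n}. D i = 0}.
          (1 + (\<Sum>j\<in>{j\<in>{1..n}. D j = 1 - D i}. w j i)) * resid X D Y \<mu> i)
      + 1 / real n * (\<Sum>i\<in>{1..n}.
          (2 * real (D i) - 1) * (1 - (\<Sum>j\<in>{j\<in>{1..n}. D j = 1 - D i}. w i j))
            * \<mu> (1 - D i) (X i))"
proof -
  let ?I = "{1..n}"
  let ?s = "\<lambda>i. 2 * real (D i) - 1"
  let ?R = "resid X D Y \<mu>"
  let ?opp = "\<lambda>i. {j\<in>?I. D j = 1 - D i}"
  let ?bias = "\<lambda>i. ?s i * (1 - (\<Sum>j\<in>?opp i. w i j)) * \<mu> (1 - D i) (X i)"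
  let ?f = "\<lambda>i. (1 + (\<Sum>j\<in>?opp i. w j i)) * ?R i"
  have "(\<Sum>i\<in>?I. imputed n X D Y w \<mu> i 1 - imputed n X D Y w \<mu> i 0) =
      (\<Sum>i\<in>?I. \<mu> 1 (X i) - \<mu> 0 (X i) + ?s i * ?R i - ?s i * (\<Sum>j\<in>?opp i. w i j * ?R j) + ?bias i)"
    using assms(2) by (intro sum.cong refl imputed_effect)
  also have "\<dots> = (\<Sum>i\<in>?I. \<mu> 1 (X i) - \<mu> 0 (X i))
      + ((\<Sum>i\<in>?I. ?s i * ?R i) - (\<Sum>i\<in>?I. ?s i * (\<Sum>j\<in>?opp i. w i j * ?R j)))
      + (\<Sum>i\<in>?I. ?bias i)"
    by (simp add: sum.distrib sum_subtractf)
  also have "(\<Sum>i\<in>?I. ?s i * ?R i) - (\<Sum>i\<in>?I. ?s i * (\<Sum>j\<in>?opp i. w i j * ?R j)) =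
      (\<Sum>i\<in>?I. ?s i * ?R i) + (\<Sum>j\<in>?I. ?s j * (\<Sum>i\<in>?opp j. w i j * ?R j))"
    using assms(2) by (subst signed_opposite_sum_swap) auto
  also have "\<dots> = (\<Sum>i\<in>?I. ?s i * ?f i)"
    unfolding sum.distrib[symmetric]
    by (simp only: sum_distrib_right[symmetric] distrib_left distrib_right mult_1_left)
  also have "\<dots> = (\<Sum>i\<in>{i\<in>?I. D i = 1}. ?f i) - (\<Sum>i\<in>{i\<in>?I. D i = 0}. ?f i)"
    using assms(2) by (intro signed_sum_by_arm) auto
  finally show ?thesis
    unfolding tau_w_def tau_reg_def by (simp only: distrib_left right_diff_distrib add_diff_eq)
qed

end
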